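(* The following statements are equivalent: (F1) every vector $x\in\mathbb{R}^m$ is attainable by Player 1; (F2) $v_\lambda>0$ for every $\lambda\in\mathbb{R}^m\setminus\{\vec 0\}$.
   Context: **Game.** $A_1,A_2$ are finite nonempty action sets of Players 1 and 2, $m\ge 1$ is an integer, and $u:A_1\times A_2\to[-1,1]^m$ is a vector payoff function, extended bilinearly to $\Delta(A_1)\times\Delta(A_2)$, where $\Delta(A_i)$ is the set of mixed actions (probability distributions on $A_i$). $G=(A_1,A_2,u)$ is the one-shot game. The continuous-time game $\Gamma$ based on $G$ is played over $[0,\infty)$. **Strategies.** Let $\mathcal{C}_i$ be the set of controls of player $i$, i.e. measurable functions $a_i:[0,\infty)\to\Delta(A_i)$; $-i$ denotes the opponent of $i$. A strategy of player $i$ is a function $\sigma_i:\mathcal{C}_{-i}\to\mathcal{C}_i$ for which there is a strictly increasing sequence $0=\tau_i^0<\tau_i^1<\tau_i^2<\cdots$ of real numbers with $\tau_i^k\to\infty$ such that for all $a_{-i},a'_{-i}\in\mathcal{C}_{-i}$ and all $k\ge 0$: if $a_{-i}(t)=a'_{-i}(t)$ for all $t\in[0,\tau_i^k)$, then $(\sigma_i(a_{-i}))(t)=(\sigma_i(a'_{-i}))(t)$ for all $t\in[\tau_i^k,\tau_i^{k+1})$. A pair of strategies $\sigma=(\sigma_1,\sigma_2)$ determines a unique play path $a^\sigma=(a_1,a_2)\in\mathcal{C}_1\times\mathcal{C}_2$ with $\sigma_1(a_2)=a_1$ and $\sigma_2(a_1)=a_2$. **Payoffs.** The cumulative payoff up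 to time $t$ is $\gamma^t(\sigma)=\int_0^t u(a^\sigma(s))\,ds\in\mathbb{R}^m$. **Distance.** $\|\cdot\|$ is the Euclidean norm and $d(x,A)=\inf_{y\in A}\|x-y\|$. **Attainability.** A nonempty closed set $Y\subseteq\mathbb{R}^m$ is attainable by Player 1 if there is $T>0$ such that for every $\varepsilon>0$ there is a strategy $\sigma_1$ of Player 1 with $d(\gamma^t(\sigma_1,\sigma_2),Y)\le\varepsilon$ for all $t\ge T$ and all strategies $\sigma_2$ of Player 2. A vector $x$ is attainable by Player 1 if $\{x\}$ is. **Projected games.** For $\lambda\in\mathbb{R}^m$, $v_\lambda$ is the value of the zero-sum one-shot game with action sets $A_1,A_2$ in which Player 2 pays Player 1 the amount $\langle\lambda,u(a_1,a_2)\rangle$; i.e. $v_\lambda=\max_{p\in\Delta(A_1)}\min_{q\in\Delta(A_2)}\langle\lambda,u(p,q)\rangle$. *)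

theory Defs
  imports "HOL-Analysis.Analysis"
begin

text \<open>
  The action sets of the two players are the finite (and nonempty) types \<open>'a\<close> and \<open>'b\<close>;
  payoffs live in \<open>real ^ 'm\<close>.
\<close>

definition mixed_actions :: "(real ^ 'c::finite) set" where
  "mixed_actions = {p. (\<forall>c. 0 \<le> p $ c) \<and> (\<Sum>c\<in>UNIV. p $ c) = 1}"

definition mixed_payoff ::
  "('a::finite \<Rightarrow> 'b::finite \<Rightarrow> real ^ 'm) \<Rightarrow> real ^ 'a \<Rightarrow> real ^ 'b \<Rightarrow> real ^ 'm" where
  "mixed_payoff u p q = (\<Sum>a\<in>UNIV. \<Sum>b\<in>UNIV. (p $ a * q $ b) *\<^sub>R u a b)"

text \<open>
  Controls are functions on the half-line \<open>{0..}\<close>. They are represented extensionally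
  (value \<open>undefined\<close> at negative times), so that HOL equality of two controls is equality
  on \<open>{0..}\<close>. Measurability is Lebesgue measurability.
\<close>

definition controls :: "(real \<Rightarrow> real ^ 'c::finite) set" where
  "controls = ({0..} \<rightarrow>\<^sub>E mixed_actions) \<inter> borel_measurable (lebesgue_on {0..})"

text \<open>
  One definition serves both players: \<open>'o\<close> is the action type of the opponent and \<open>'c\<close>
  that of the player. Only the values of a strategy on controls matter. For \<open>k = 0\<close> the
  condition says that the play on \<open>{\<tau> 0..<\<tau> 1}\<close> does not depend on the opponent.
\<close>

definition strategies ::
  "((real \<Rightarrow> real ^ 'o::finite) \<Rightarrow> (real \<Rightarrow> real ^ 'c::finite)) set" where
  "strategies = {\<sigma>. \<sigma> \<in> controls \<rightarrow> controls \<and>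
     (\<exists>\<tau> :: nat \<Rightarrow> real. \<tau> 0 = 0 \<and> strict_mono \<tau> \<and> filterlim \<tau> at_top sequentially \<and>
        (\<forall>x\<in>controls. \<forall>y\<in>controls. \<forall>k.
           (\<forall>t\<in>{0..<\<tau> k}. x t = y t) \<longrightarrow> (\<forall>t\<in>{\<tau> k..<\<tau> (Suc k)}. \<sigma> x t = \<sigma> y t)))}"

text \<open>
  For a pair of strategies there is exactly one pair of controls as described below: both
  controls are determined successively on the intervals of the grid that merges the two
  sequences \<open>\<tau>\<close>.
\<close>

definition play_path ::
  "((real \<Rightarrow> real ^ 'b) \<Rightarrow> (real \<Rightarrow> real ^ 'a)) \<Rightarrow>
   ((real \<Rightarrow> real ^ 'a) \<Rightarrow> (real \<Rightarrow> real ^ 'b)) \<Rightarrow>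
   (real \<Rightarrow> real ^ 'a::finite) \<times> (real \<Rightarrow> real ^ 'b::finite)" where
  "play_path \<sigma>1 \<sigma>2 = (THE (a1, a2). a1 \<in> controls \<and> a2 \<in> controls \<and> \<sigma>1 a2 = a1 \<and> \<sigma>2 a1 = a2)"

definition cumulative_payoff ::
  "('a::finite \<Rightarrow> 'b::finite \<Rightarrow> real ^ 'm) \<Rightarrow>
   ((real \<Rightarrow> real ^ 'b) \<Rightarrow> (real \<Rightarrow> real ^ 'a)) \<Rightarrow>
   ((real \<Rightarrow> real ^ 'a) \<Rightarrow> (real \<Rightarrow> real ^ 'b)) \<Rightarrow> real \<Rightarrow> real ^ 'm" where
  "cumulative_payoff u \<sigma>1 \<sigma>2 t =
     (case play_path \<sigma>1 \<sigma>2 of (a1, a2) \<Rightarrow> (LINT s:{0..t}|lebesgue. mixed_payoff u (a1 s) (a2 s)))"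

definition attainable_set ::
  "('a::finite \<Rightarrow> 'b::finite \<Rightarrow> real ^ 'm) \<Rightarrow> (real ^ 'm) set \<Rightarrow> bool" where
  "attainable_set u Y \<longleftrightarrow> Y \<noteq> {} \<and> closed Y \<and>
     (\<exists>T>0. \<forall>\<epsilon>>0. \<exists>\<sigma>1\<in>strategies. \<forall>t\<ge>T. \<forall>\<sigma>2\<in>strategies.
        infdist (cumulative_payoff u \<sigma>1 \<sigma>2 t) Y \<le> \<epsilon>)"

definition attainable ::
  "('a::finite \<Rightarrow> 'b::finite \<Rightarrow> real ^ 'm) \<Rightarrow> real ^ 'm \<Rightarrow> bool" where
  "attainable u x \<longleftrightarrow> attainable_set u {x}"

text \<open>
  The supremum and infimum below are a maximum and a minimum: \<open>mixed_actions\<close> is nonempty and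
  compact, and the payoff is bilinear.
\<close>

definition projected_value ::
  "('a::finite \<Rightarrow> 'b::finite \<Rightarrow> real ^ 'm) \<Rightarrow> real ^ 'm \<Rightarrow> real" where
  "projected_value u l = (SUP p\<in>mixed_actions. INF q\<in>mixed_actions. l \<bullet> mixed_payoff u p q)"

end

theory Submission
  imports Defs
begin

text \<open>
  Attaining \<open>x\<close> is a game about the gap between the cumulative payoff and \<open>x\<close>.

  If the projection in some direction \<open>l \<noteq> 0\<close> has value at most \<open>0\<close>, then Player 2 has a single
  mixed action \<open>q\<close> that keeps \<open>\<langle>l, u(p, q)\<rangle> \<le> 0\<close> for every \<open>p\<close>. Playing \<open>q\<close> forever confines the
  cumulative payoff to a half-space whose distance from \<open>l\<close> is \<open>norm l\<close>, so \<open>l\<close> is not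
  attainable. The step from the value, which is a maximin, to the action \<open>q\<close> is the minimax
  theorem for finite games, obtained here by separating the achievable payoff vectors from the
  positive orthant (\<open>opponent_defends\<close>).

  If every value is positive, then compactness of the unit sphere gives one constant \<open>c > 0\<close> with
  which Player 1 can guarantee \<open>\<langle>l, u(p, q)\<rangle> \<ge> c * norm l\<close> in every direction \<open>l\<close>
  (\<open>uniform_advantage\<close>). Player 1 observes the gap \<open>g\<close> at the times \<open>k * d\<close> and during the next
  period of length \<open>d\<close> plays the action that is good in direction \<open>- g\<close>. As in Blackwell's
  approachability argument, with a bound \<open>M\<close> on payoffs the squared length of the gap changes by at
  most \<open>- 2 * c * d * norm g + (M * d)\<^sup>2\<close>. Because payoffs accumulate instead of being averaged, the
  gap shrinks at a speed that does not tend to \<open>0\<close>, namely at least \<open>c / 2\<close>, until its length is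
  of order \<open>d\<close>, and it stays of that order (\<open>pursuit_gap_le\<close>). The time which this takes is bounded
  in terms of \<open>norm x\<close> and \<open>c\<close> alone, and \<open>d\<close> can be chosen small once that time is fixed; this is the
  order of quantifiers in attainability.

  Both directions evaluate the payoff along the play path, which is defined as the unique solution
  of a fixed point equation. Existence and uniqueness (\<open>ex1_play_path\<close>) hold because each
  strategy reacts only after a positive delay.
\<close>

section \<open>The zero-sum projections of the game\<close>

lemma mixed_actions_axis: "axis c 1 \<in> mixed_actions"
  by (simp add: mixed_actions_def axis_def)

text \<open>
  For a fixed action of Player 1 the payoff is an average over the pure replies of Player 2, so bounds
  against the pure replies \<open>axis b 1\<close> are bounds against all mixed ones.
\<close>
lemma inner_mixed_payoff:
  "l \<bullet> mixed_payoff u p q = (\<Sum>b\<in>UNIV. q $ b * (l \<bullet> mixed_payoff u p (axis b 1)))"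
proof -
  have "l \<bullet> mixed_payoff u p q = (\<Sum>b\<in>UNIV. \<Sum>a\<in>UNIV. p $ a * q $ b * (l \<bullet> u a b))"
    unfolding mixed_payoff_def inner_sum_right by (subst sum.swap) simp
  moreover have "l \<bullet> mixed_payoff u p (axis b 1) = (\<Sum>a\<in>UNIV. p $ a * (l \<bullet> u a b))" for b
    unfolding mixed_payoff_def inner_sum_right axis_def
    by (simp add: if_distrib[of "\<lambda>x. _ * x"] if_distrib[of "\<lambda>x. x * _"] sum.delta cong: if_cong)
  ultimately show ?thesis by (simp add: sum_distrib_left mult_ac)
qed

lemma mixed_payoff_add_left:
  "mixed_payoff u (p + p') q = mixed_payoff u p q + mixed_payoff u p' q"
  by (simp add: mixed_payoff_def algebra_simps sum.distrib)

lemma mixed_payoff_scale_left: "mixed_payoff u (r *\<^sub>R p) q = r *\<^sub>R mixed_payoff u p q"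
  by (simp add: mixed_payoff_def scaleR_sum_right mult.assoc)

lemma norm_mixed_payoff_le:
  assumes "\<And>a b. norm (u a b) \<le> M" "p \<in> mixed_actions" "q \<in> mixed_actions"
  shows "norm (mixed_payoff u p q) \<le> M"
proof -
  have nn: "0 \<le> p $ a * q $ b" for a b using assms by (auto simp: mixed_actions_def)
  have "norm (mixed_payoff u p q) \<le> (\<Sum>a\<in>UNIV. \<Sum>b\<in>UNIV. norm ((p $ a * q $ b) *\<^sub>R u a b))"
    unfolding mixed_payoff_def by (intro order.trans[OF norm_sum] sum_mono norm_sum)
  also have "\<dots> \<le> (\<Sum>a\<in>UNIV. \<Sum>b\<in>UNIV. p $ a * (q $ b * M))"
  proof (intro sum_mono)
    fix a b
    have "norm ((p $ a * q $ b) *\<^sub>R u a b) = (p $ a * q $ b) * norm (u a b)" using nn[of a b] by simp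
    also have "\<dots> \<le> (p $ a * q $ b) * M" by (rule mult_left_mono[OF assms(1) nn])
    finally show "norm ((p $ a * q $ b) *\<^sub>R u a b) \<le> p $ a * (q $ b * M)" by (simp add: mult.assoc)
  qed
  also have "\<dots> = M"
    using assms(2,3) by (simp add: sum_distrib_left[symmetric] sum_distrib_right[symmetric] mixed_actions_def)
  finally show ?thesis .
qed

lemma inner_mixed_payoff_ge:
  assumes "q \<in> mixed_actions" "\<And>b. c \<le> l \<bullet> mixed_payoff u p (axis b 1)"
  shows "c \<le> l \<bullet> mixed_payoff u p q"
proof -
  have "c = (\<Sum>b\<in>UNIV. q $ b * c)"
    using assms(1) by (simp add: sum_distrib_right[symmetric] mixed_actions_def)
  also have "\<dots> \<le> l \<bullet> mixed_payoff u p q"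
    unfolding inner_mixed_payoff[of l u p q] using assms
    by (intro sum_mono mult_left_mono) (auto simp: mixed_actions_def)
  finally show ?thesis .
qed

lemma payoffs_bounded:
  fixes u :: "'a::finite \<Rightarrow> 'b::finite \<Rightarrow> 'v::real_normed_vector"
  obtains M where "1 \<le> M" "\<And>a b. norm (u a b) \<le> M"
proof
  show "norm (u a b) \<le> (\<Sum>a\<in>UNIV. \<Sum>b\<in>UNIV. norm (u a b)) + 1" for a b
    using member_le_sum[of a UNIV "\<lambda>a. \<Sum>b\<in>UNIV. norm (u a b)"]
      member_le_sum[of b UNIV "\<lambda>b. norm (u a b)"] by (simp add: sum_nonneg)
qed (simp add: sum_nonneg)

text \<open>
  A supremum is positive exactly if some element is, and the infimum over mixed replies is the
  minimum over the finitely many pure ones, which is positive exactly if each of them is.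
\<close>
lemma projected_value_pos_iff:
  "0 < projected_value u l \<longleftrightarrow> (\<exists>p\<in>mixed_actions. \<forall>b. 0 < l \<bullet> mixed_payoff u p (axis b 1))"
    (is "_ \<longleftrightarrow> ?R")
proof -
  obtain M where M: "\<And>a b. norm (u a b) \<le> M" using payoffs_bounded[of u] by metis
  have bnd: "\<bar>l \<bullet> mixed_payoff u p q\<bar> \<le> norm l * M"
    if "p \<in> mixed_actions" "q \<in> mixed_actions" for p q
    using Cauchy_Schwarz_ineq2[of l] norm_mixed_payoff_le[of u M, OF M that]
    by (meson mult_left_mono norm_ge_zero order_trans)
  define I where "I p = (INF q\<in>mixed_actions. l \<bullet> mixed_payoff u p q)" for p
  have below: "bdd_below ((\<lambda>q. l \<bullet> mixed_payoff u p q) ` mixed_actions)" if "p \<in> mixed_actions" for p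
    using bnd[OF that] by (intro bdd_belowI2[of _ "- (norm l * M)"]) (auto simp: abs_le_iff minus_le_iff)
  have Ile: "I p \<le> l \<bullet> mixed_payoff u p q"
    if "p \<in> mixed_actions" "q \<in> mixed_actions" for p q
    unfolding I_def by (rule cINF_lower[OF below]) (use that in auto)
  have above: "bdd_above (I ` mixed_actions)"
  proof (rule bdd_aboveI2)
    show "I p \<le> norm l * M" if "p \<in> mixed_actions" for p
      using Ile[OF that mixed_actions_axis] bnd[OF that mixed_actions_axis] by (meson abs_le_D1 order_trans)
  qed
  have ne: "(mixed_actions :: (real ^ 'k::finite) set) \<noteq> {}" using mixed_actions_axis by blast
  have "0 < projected_value u l \<longleftrightarrow> (\<exists>p\<in>mixed_actions. 0 < I p)"
    unfolding projected_value_def I_def[symmetric] by (rule less_cSUP_iff[OF ne above])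
  also have "\<dots> \<longleftrightarrow> ?R"
  proof (intro bex_cong refl iffI allI)
    show "0 < l \<bullet> mixed_payoff u p (axis b 1)" if "p \<in> mixed_actions" "0 < I p" for p b
      using Ile[OF that(1) mixed_actions_axis] that(2) by (rule order.strict_trans2[rotated])
    show "0 < I p" if "p \<in> mixed_actions" "\<forall>b. 0 < l \<bullet> mixed_payoff u p (axis b 1)" for p
    proof -
      define c where "c = Min (range (\<lambda>b. l \<bullet> mixed_payoff u p (axis b 1)))"
      have "c \<le> l \<bullet> mixed_payoff u p (axis b 1)" for b
        unfolding c_def by (intro Min_le) auto
      then have "c \<le> l \<bullet> mixed_payoff u p q" if "q \<in> mixed_actions" for q
        by (rule inner_mixed_payoff_ge[OF that])
      then have "c \<le> I p" unfolding I_def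
        by (rule cINF_greatest[OF ne])
      moreover have "0 < c" using that(2) by (simp add: c_def)
      ultimately show ?thesis by linarith
    qed
  qed
  finally show ?thesis .
qed

lemma convex_mixed_actions: "convex mixed_actions"
proof (rule convexI)
  fix p q :: "real ^ 'k" and s t :: real
  assume "p \<in> mixed_actions" "q \<in> mixed_actions" "0 \<le> s" "0 \<le> t" "s + t = 1"
  then show "s *\<^sub>R p + t *\<^sub>R q \<in> mixed_actions"
    by (auto simp: mixed_actions_def sum.distrib sum_distrib_left[symmetric])
qed

text \<open>
  The minimax theorem, in the one-sided form that is needed here. If Player 1 cannot guarantee a positive
  amount, then the convex set \<open>W\<close> of vectors of payoffs against the pure replies misses the open
  positive orthant. The normal vector of a separating hyperplane has nonnegative entries, and
  scaling it to total weight \<open>1\<close> gives the defence \<open>q\<close>.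
\<close>
lemma opponent_defends:
  assumes "\<not> 0 < projected_value u l"
  shows "\<exists>q\<in>mixed_actions. \<forall>p\<in>mixed_actions. l \<bullet> mixed_payoff u p q \<le> 0"
proof -
  define W where "W = (\<lambda>p. \<chi> b. l \<bullet> mixed_payoff u p (axis b 1)) ` mixed_actions"
  define Pos where "Pos = {w :: real ^ 'b. \<forall>b. 0 < w $ b}"
  have "linear (\<lambda>p. (\<chi> b. l \<bullet> mixed_payoff u p (axis b 1)) :: real ^ 'b)"
    by (rule linearI) (simp_all add: vec_eq_iff mixed_payoff_add_left mixed_payoff_scale_left inner_add_right)
  then have "convex W" unfolding W_def
    by (rule convex_linear_image[OF _ convex_mixed_actions])
  moreover have "convex Pos"
  proof (rule convexI)
    fix x y :: "real ^ 'b" and s t :: real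
    assume "x \<in> Pos" "y \<in> Pos" and st: "0 \<le> s" "0 \<le> t" "s + t = 1"
    then have "0 < s * x $ b + t * y $ b" for b
      by (cases "s = 0") (auto simp: Pos_def less_imp_le intro!: add_pos_nonneg mult_nonneg_nonneg)
    then show "s *\<^sub>R x + t *\<^sub>R y \<in> Pos" by (simp add: Pos_def)
  qed
  moreover have "W \<noteq> {}" using mixed_actions_axis by (auto simp: W_def)
  moreover have "(\<chi> b. 1) \<in> Pos" by (simp add: Pos_def)
  moreover have "W \<inter> Pos = {}"
    using assms by (auto simp: projected_value_pos_iff W_def Pos_def)
  ultimately obtain v r where "v \<noteq> 0" and W: "\<And>w. w \<in> W \<Longrightarrow> v \<bullet> w \<le> r"
    and Pos: "\<And>w. w \<in> Pos \<Longrightarrow> r \<le> v \<bullet> w"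
    using separating_hyperplane_sets[of W Pos] by blast
  have Pos_closure: "r \<le> v \<bullet> w" if "\<And>b. 0 \<le> w $ b" for w
  proof -
    have "((\<lambda>e. v \<bullet> (w + e *\<^sub>R (\<chi> b. 1))) \<longlongrightarrow> v \<bullet> (w + 0 *\<^sub>R (\<chi> b. 1))) (at_right 0)"
      by (intro tendsto_intros)
    moreover have "eventually (\<lambda>e. r \<le> v \<bullet> (w + e *\<^sub>R (\<chi> b. 1))) (at_right 0)"
      unfolding eventually_at_right_field
      by (intro exI[of _ 1]) (auto intro!: Pos simp: Pos_def that add_nonneg_pos)
    ultimately show ?thesis
      using tendsto_lowerbound[OF _ _ trivial_limit_at_right_real] by force
  qed
  have "r \<le> 0" using Pos_closure[of 0] by simp
  have v_nonneg: "0 \<le> v $ b" for b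
  proof (rule ccontr)
    assume "\<not> 0 \<le> v $ b"
    \<comment> \<open>A large multiple of the \<open>b\<close>-th unit vector lies in the closed orthant, but on the wrong side.\<close>
    have "r \<le> v \<bullet> axis b ((r - 1) / v $ b)"
      using \<open>r \<le> 0\<close> \<open>\<not> 0 \<le> v $ b\<close> by (intro Pos_closure) (auto simp: axis_def divide_nonpos_neg)
    then show False using \<open>\<not> 0 \<le> v $ b\<close> by (simp add: inner_axis)
  qed
  define S where "S = (\<Sum>b\<in>UNIV. v $ b)"
  have "S \<noteq> 0" using \<open>v \<noteq> 0\<close> v_nonneg by (auto simp: S_def sum_nonneg_eq_0_iff vec_eq_iff)
  then have "0 < S" using v_nonneg by (simp add: S_def sum_nonneg order_less_le)
  define q where "q = (1 / S) *\<^sub>R v"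
  have "q \<in> mixed_actions"
    using \<open>0 < S\<close> v_nonneg
    by (auto simp: q_def mixed_actions_def sum_divide_distrib[symmetric] S_def[symmetric])
  moreover have "l \<bullet> mixed_payoff u p q \<le> 0" if "p \<in> mixed_actions" for p
  proof -
    have "l \<bullet> mixed_payoff u p q = (1 / S) * (v \<bullet> (\<chi> b. l \<bullet> mixed_payoff u p (axis b 1)))"
      unfolding inner_mixed_payoff[of l u p q] by (simp add: q_def inner_vec_def sum_divide_distrib)
    moreover have "v \<bullet> (\<chi> b. l \<bullet> mixed_payoff u p (axis b 1)) \<le> 0"
      using W[of "\<chi> b. l \<bullet> mixed_payoff u p (axis b 1)"] that \<open>r \<le> 0\<close> by (force simp: W_def)
    ultimately show ?thesis using \<open>0 < S\<close> by (simp add: divide_nonpos_pos)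
  qed
  ultimately show ?thesis by blast
qed

text \<open>
  An action that guarantees more than \<open>d\<close> in one direction does so in all nearby directions.
  Finitely many such neighbourhoods cover the unit sphere, and both sides of the inequality are homogeneous in \<open>l\<close>.
\<close>
lemma uniform_advantage:
  fixes u :: "'a::finite \<Rightarrow> 'b::finite \<Rightarrow> real ^ 'm::finite"
  assumes "\<And>l. l \<noteq> 0 \<Longrightarrow> 0 < projected_value u l"
  obtains c where "0 < c"
    "\<And>l. \<exists>p\<in>mixed_actions. \<forall>q\<in>mixed_actions. c * norm l \<le> l \<bullet> mixed_payoff u p q"
proof -
  define U where "U pc = {l. \<forall>b. snd pc < l \<bullet> mixed_payoff u (fst pc) (axis b 1)}" for pc :: "(real ^ 'a) \<times> real"
  have "open (U pc)" for pc
  proof -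
    have "U pc = (\<Inter>b\<in>UNIV. {l. snd pc < l \<bullet> mixed_payoff u (fst pc) (axis b 1)})"
      by (auto simp: U_def)
    also have "open \<dots>"
      by (intro open_INT finite ballI open_Collect_less continuous_intros)
    finally show ?thesis .
  qed
  moreover have "sphere (0 :: real ^ 'm) 1 \<subseteq> (\<Union>pc\<in>mixed_actions \<times> {0<..}. U pc)"
  proof
    fix l :: "real ^ 'm" assume "l \<in> sphere 0 1"
    then have "l \<noteq> 0" by auto
    then obtain p where p: "p \<in> mixed_actions" "\<And>b. 0 < l \<bullet> mixed_payoff u p (axis b 1)"
      using assms projected_value_pos_iff by blast
    define c where "c = Min (range (\<lambda>b. l \<bullet> mixed_payoff u p (axis b 1))) / 2"
    have "0 < c" using p(2) by (simp add: c_def)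
    moreover have "c < l \<bullet> mixed_payoff u p (axis b 1)" for b
    proof -
      have "2 * c \<le> l \<bullet> mixed_payoff u p (axis b 1)" by (simp add: c_def)
      then show ?thesis using \<open>0 < c\<close> by linarith
    qed
    ultimately show "l \<in> (\<Union>pc\<in>mixed_actions \<times> {0<..}. U pc)"
      using p(1) by (intro UN_I[of "(p, c)"]) (auto simp: U_def)
  qed
  ultimately obtain D where D: "D \<subseteq> mixed_actions \<times> {0<..}" "finite D" "sphere 0 1 \<subseteq> (\<Union>pc\<in>D. U pc)"
    using compactE_image[OF compact_sphere] by metis
  define c where "c = Min (insert 1 (snd ` D))"
  have "0 < c" using D(1,2) by (auto simp: c_def)
  moreover have "\<exists>p\<in>mixed_actions. \<forall>q\<in>mixed_actions. c * norm l \<le> l \<bullet> mixed_payoff u p q" for l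
  proof (cases "l = 0")
    case True
    then show ?thesis using mixed_actions_axis by auto
  next
    case False
    then have "(1 / norm l) *\<^sub>R l \<in> sphere 0 1" by simp
    then obtain p d where pd: "(p, d) \<in> D" "(1 / norm l) *\<^sub>R l \<in> U (p, d)"
      using D(3) by fastforce
    then have "c \<le> d" using D(2) by (force simp: c_def intro!: Min_le)
    have "c * norm l \<le> l \<bullet> mixed_payoff u p (axis b 1)" for b
    proof -
      have "d < (l \<bullet> mixed_payoff u p (axis b 1)) / norm l"
        using pd(2) by (auto simp: U_def)
      then have "c \<le> (l \<bullet> mixed_payoff u p (axis b 1)) / norm l" using \<open>c \<le> d\<close> by linarith
      then show ?thesis using False by (simp add: pos_le_divide_eq)
    qed
    then show ?thesis using pd(1) D(1) inner_mixed_payoff_ge by blast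
  qed
  ultimately show ?thesis using that by blast
qed

section \<open>Play paths\<close>

definition time_grid :: "(nat \<Rightarrow> real) \<Rightarrow> bool" where
  "time_grid \<tau> \<longleftrightarrow> \<tau> 0 = 0 \<and> strict_mono \<tau> \<and> filterlim \<tau> at_top sequentially"

lemma time_grid_slot:
  assumes "time_grid \<tau>" "0 \<le> s"
  obtains k where "\<tau> k \<le> s" "s < \<tau> (Suc k)"
proof -
  have "eventually (\<lambda>n. s + 1 \<le> \<tau> n) sequentially"
    using assms by (simp add: filterlim_at_top time_grid_def)
  then obtain n where "s + 1 \<le> \<tau> n"
    by (auto simp: eventually_sequentially)
  then have "s < \<tau> n" by simp
  moreover have "\<tau> 0 \<le> s" using assms by (simp add: time_grid_def)
  ultimately obtain k where "\<not> s < \<tau> k" "s < \<tau> (Suc k)"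
    using ex_least_nat_less[of "\<lambda>k. s < \<tau> k" n] by force
  then show ?thesis using that by (simp add: not_less)
qed

lemma finite_time_grid_less:
  assumes "time_grid \<tau>"
  shows "finite {g \<in> range \<tau>. g < s}"
proof -
  have "eventually (\<lambda>n. s \<le> \<tau> n) sequentially"
    using assms by (simp add: filterlim_at_top time_grid_def)
  then obtain N where N: "\<And>n. n \<ge> N \<Longrightarrow> s \<le> \<tau> n"
    by (auto simp: eventually_sequentially)
  have "{g \<in> range \<tau>. g < s} \<subseteq> \<tau> ` {..<N}"
  proof clarify
    fix n assume "\<tau> n < s"
    then have "n < N" using N[of n] by (meson not_le)
    then show "\<tau> n \<in> \<tau> ` {..<N}" by simp
  qed
  then show ?thesis using finite_surj by blast
qed

text \<open>
  Only finitely many grid points of the two players precede a given time, so the number of them serves as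
  an induction measure on real time. Going back from \<open>t\<close> to the last grid point \<open>r\<close> before it, neither
  player updates strictly between \<open>r\<close> and \<open>t\<close>.
\<close>
lemma two_grids_induct [consumes 3, case_names zero step]:
  assumes "time_grid \<tau>1" "time_grid \<tau>2" "0 \<le> t"
    and zero: "R 0"
    and step: "\<And>r t i j. \<lbrakk>R r; \<tau>1 i \<le> r; t \<le> \<tau>1 (Suc i); \<tau>2 j \<le> r; t \<le> \<tau>2 (Suc j)\<rbrakk> \<Longrightarrow> R t"
  shows "R t"
proof -
  define G where "G s = {g \<in> range \<tau>1. g < s} \<union> {g \<in> range \<tau>2. g < s}" for s
  have finG: "finite (G s)" for s
    unfolding G_def using finite_time_grid_less assms(1,2) by blast
  have slot: "\<exists>i. \<tau> i \<le> r \<and> s \<le> \<tau> (Suc i)"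
    if "time_grid \<tau>" "0 \<le> r" "\<And>n. \<tau> n < s \<Longrightarrow> \<tau> n \<le> r" for \<tau> r s
    using time_grid_slot[OF that(1,2)] that(3) by (metis not_le)
  show ?thesis using \<open>0 \<le> t\<close>
  proof (induction "card (G t)" arbitrary: t rule: less_induct)
    case less
    show ?case
    proof (cases "t = 0")
      case True then show ?thesis using zero by simp
    next
      case False
      then have "0 \<in> G t" using less.prems assms(1) unfolding G_def time_grid_def
        by (auto intro!: image_eqI[of _ _ 0])
      define r where "r = Max (G t)"
      have r: "r \<in> G t" "0 \<le> r" "\<And>g. g \<in> G t \<Longrightarrow> g \<le> r"
        using Max_in[OF finG, of t] Max_ge[OF finG, of _ t] \<open>0 \<in> G t\<close>
        by (auto simp: r_def)
      then have "r < t" by (auto simp: G_def)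
      then have "G r \<subseteq> G t" "r \<notin> G r" by (auto simp: G_def)
      then have "card (G r) < card (G t)"
        using r(1) by (metis finG psubsetI psubset_card_mono)
      then have "R r" using less.hyps r(2) by blast
      moreover obtain i where "\<tau>1 i \<le> r" "t \<le> \<tau>1 (Suc i)"
        using slot[of \<tau>1 r t] assms(1) r(2,3) by (auto simp: G_def)
      moreover obtain j where "\<tau>2 j \<le> r" "t \<le> \<tau>2 (Suc j)"
        using slot[of \<tau>2 r t] assms(2) r(2,3) by (auto simp: G_def)
      ultimately show ?thesis by (rule step)
    qed
  qed
qed

lemma time_grid_uniform: "0 < d \<Longrightarrow> time_grid (\<lambda>k. real k * d)"
  unfolding time_grid_def
  by (auto intro!: strict_monoI filterlim_tendsto_pos_mult_at_top[OF tendsto_const]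
      filterlim_at_top_mult_tendsto_pos[OF tendsto_const] filterlim_real_sequentially)

definition delay_grid where
  "delay_grid \<sigma> \<tau> \<longleftrightarrow> time_grid \<tau> \<and>
        (\<forall>x\<in>controls. \<forall>y\<in>controls. \<forall>k.
           (\<forall>t\<in>{0..<\<tau> k}. x t = y t) \<longrightarrow> (\<forall>t\<in>{\<tau> k..<\<tau> (Suc k)}. \<sigma> x t = \<sigma> y t))"

lemma strategies_eq: "strategies = {\<sigma>. \<sigma> \<in> controls \<rightarrow> controls \<and> (\<exists>\<tau>. delay_grid \<sigma> \<tau>)}"
  by (simp add: strategies_def delay_grid_def time_grid_def)

text \<open>
  The delay condition speaks of one slot only. Since earlier slots depend on even less of the opponent's
  control, agreement before \<open>\<tau> k\<close> in fact determines the response up to \<open>\<tau> (Suc k)\<close>.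
\<close>
lemma delay_grid_agree:
  assumes g: "delay_grid \<sigma> \<tau>" and "x \<in> controls" "y \<in> controls"
    and eq: "\<forall>t\<in>{0..<\<tau> k}. x t = y t" and "0 \<le> t" "t < \<tau> (Suc k)"
  shows "\<sigma> x t = \<sigma> y t"
proof -
  have "time_grid \<tau>" "strict_mono \<tau>"
    using g by (auto simp: delay_grid_def time_grid_def)
  obtain j where j: "\<tau> j \<le> t" "t < \<tau> (Suc j)"
    using time_grid_slot[OF \<open>time_grid \<tau>\<close> \<open>0 \<le> t\<close>] .
  note \<open>strict_mono \<tau>\<close>
  moreover have "\<tau> j < \<tau> (Suc k)" using j assms by linarith
  ultimately have "j \<le> k" by (simp add: strict_mono_less)
  then have "\<tau> j \<le> \<tau> k" using \<open>strict_mono \<tau>\<close> by (simp add: strict_mono_less_eq)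
  then have "\<forall>t\<in>{0..<\<tau> j}. x t = y t" using eq by auto
  then have "\<forall>t\<in>{\<tau> j..<\<tau> (Suc j)}. \<sigma> x t = \<sigma> y t"
    using g assms(2,3) unfolding delay_grid_def by blast
  then show ?thesis using j by simp
qed

lemma controls_eqI:
  assumes "x \<in> controls" "y \<in> controls" "\<And>t. 0 \<le> t \<Longrightarrow> x t = y t"
  shows "x = y"
  using assms by (intro ext) (force simp: controls_def PiE_def extensional_def)

lemma constant_control: "p \<in> mixed_actions \<Longrightarrow> (\<lambda>t\<in>{0..}. p) \<in> controls"
proof -
  assume "p \<in> mixed_actions"
  moreover have "(\<lambda>t\<in>{0..}. p) \<in> borel_measurable (lebesgue_on {0..})"
    by (subst measurable_cong[where g = "\<lambda>_. p"]) auto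
  ultimately show ?thesis by (auto simp: controls_def)
qed

text \<open>
  Play paths are the fixed points of the simultaneous response map \<open>F\<close>. By the delays, whenever two
  pairs agree up to a grid point, their images under \<open>F\<close> agree up to the next one. Hence on every bounded
  interval all iterates of \<open>F\<close> from a certain index on coincide, whatever pair they start from
  (\<open>stable\<close>). Fixed points are their own iterates, which gives uniqueness; the eventual values of one
  sequence of iterates form a fixed point, which gives existence.
\<close>
lemma ex1_play_path:
  fixes \<sigma>1 :: "(real \<Rightarrow> real ^ 'b::finite) \<Rightarrow> (real \<Rightarrow> real ^ 'a::finite)"
  assumes s: "\<sigma>1 \<in> strategies" "\<sigma>2 \<in> strategies"
  shows "\<exists>!(a1, a2). a1 \<in> controls \<and> a2 \<in> controls \<and> \<sigma>1 a2 = a1 \<and> \<sigma>2 a1 = a2"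
proof -
  obtain \<tau>1 \<tau>2 where g1: "delay_grid \<sigma>1 \<tau>1" and g2: "delay_grid \<sigma>2 \<tau>2"
    using s by (auto simp: strategies_eq)
  then have t1: "time_grid \<tau>1" and t2: "time_grid \<tau>2" by (auto simp: delay_grid_def)
  define C where "C = (controls :: (real \<Rightarrow> real ^ 'a) set) \<times> (controls :: (real \<Rightarrow> real ^ 'b) set)"
  define F where "F = (\<lambda>(a1, a2). (\<sigma>1 a2, \<sigma>2 a1))"
  define E where "E t a b \<longleftrightarrow> (\<forall>s\<in>{0..<t}. fst a s = fst b s \<and> snd a s = snd b s)"
    for t :: real and a b :: "(real \<Rightarrow> real ^ 'a) \<times> (real \<Rightarrow> real ^ 'b)"
  have FC: "F a \<in> C" if "a \<in> C" for a
    using that s by (auto simp: F_def C_def strategies_eq)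
  have FnC: "(F ^^ n) a \<in> C" if "a \<in> C" for a n
    by (induction n) (auto simp: that FC)
  have E_step: "E t (F a) (F b)"
    if "E r a b" "a \<in> C" "b \<in> C" "\<tau>1 i \<le> r" "t \<le> \<tau>1 (Suc i)" "\<tau>2 j \<le> r" "t \<le> \<tau>2 (Suc j)"
    for r t a b i j
  proof -
    have "\<sigma>1 (snd a) s = \<sigma>1 (snd b) s" "\<sigma>2 (fst a) s = \<sigma>2 (fst b) s" if "s \<in> {0..<t}" for s
    proof -
      show "\<sigma>1 (snd a) s = \<sigma>1 (snd b) s"
        by (rule delay_grid_agree[OF g1, of _ _ i])
           (use \<open>s \<in> _\<close> that \<open>E r a b\<close> \<open>a \<in> C\<close> \<open>b \<in> C\<close> \<open>\<tau>1 i \<le> r\<close> \<open>t \<le> \<tau>1 (Suc i)\<close>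
             in \<open>auto simp: E_def C_def\<close>)
      show "\<sigma>2 (fst a) s = \<sigma>2 (fst b) s"
        by (rule delay_grid_agree[OF g2, of _ _ j])
           (use \<open>s \<in> _\<close> that \<open>E r a b\<close> \<open>a \<in> C\<close> \<open>b \<in> C\<close> \<open>\<tau>2 j \<le> r\<close> \<open>t \<le> \<tau>2 (Suc j)\<close>
             in \<open>auto simp: E_def C_def\<close>)
    qed
    then show ?thesis by (auto simp: E_def F_def split: prod.split)
  qed
  have E_F: "E t (F a) (F b)" if "E t a b" "a \<in> C" "b \<in> C" "0 \<le> t" for t a b
  proof -
    obtain i where "\<tau>1 i \<le> t" "t < \<tau>1 (Suc i)" using time_grid_slot[OF t1 \<open>0 \<le> t\<close>] .
    moreover obtain j where "\<tau>2 j \<le> t" "t < \<tau>2 (Suc j)" using time_grid_slot[OF t2 \<open>0 \<le> t\<close>] .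
    ultimately show ?thesis using E_step[OF that(1-3), of i t j] by simp
  qed
  have stable: "\<exists>N. \<forall>n\<ge>N. \<forall>n'\<ge>N. \<forall>a\<in>C. \<forall>b\<in>C. E t ((F ^^ n) a) ((F ^^ n') b)" if "0 \<le> t" for t
    using t1 t2 that
  proof (induction rule: two_grids_induct)
    case (step r t i j)
    note ij = step(2-5)
    from step(1) obtain N where
      N: "\<And>n n' a b. \<lbrakk>N \<le> n; N \<le> n'; a \<in> C; b \<in> C\<rbrakk> \<Longrightarrow> E r ((F ^^ n) a) ((F ^^ n') b)"
      by blast
    have "E t ((F ^^ n) a) ((F ^^ n') b)" if "Suc N \<le> n" "Suc N \<le> n'" "a \<in> C" "b \<in> C" for n n' a b
    proof -
      obtain m m' where "n = Suc m" "n' = Suc m'" "N \<le> m" "N \<le> m'"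
        using \<open>Suc N \<le> n\<close> \<open>Suc N \<le> n'\<close> by (metis Suc_le_D Suc_le_mono)
      then show ?thesis
        using E_step[OF N[OF \<open>N \<le> m\<close> \<open>N \<le> m'\<close> that(3,4)] FnC FnC ij] that by simp
    qed
    then show "\<exists>N. \<forall>n\<ge>N. \<forall>n'\<ge>N. \<forall>a\<in>C. \<forall>b\<in>C. E t ((F ^^ n) a) ((F ^^ n') b)" by blast
  qed (auto simp: E_def)
  have C_eqI: "a = b" if "a \<in> C" "b \<in> C" "\<And>t. 0 \<le> t \<Longrightarrow> E t a b" for a b
  proof -
    have "fst a s = fst b s" "snd a s = snd b s" if "0 \<le> s" for s
      using \<open>\<And>t. 0 \<le> t \<Longrightarrow> E t a b\<close>[of "s + 1"] that by (auto simp: E_def)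
    then show ?thesis using that(1,2)
      by (intro prod_eqI controls_eqI) (auto simp: C_def)
  qed
  have unique: "a = b" if "a \<in> C" "b \<in> C" "F a = a" "F b = b" for a b
  proof (rule C_eqI[OF that(1,2)])
    have "(F ^^ n) a = a" "(F ^^ n) b = b" for n
      using that(3,4) by (induction n) auto
    note iter = this
    fix t :: real assume "0 \<le> t"
    from stable[OF this] obtain N
      where "\<forall>n\<ge>N. \<forall>n'\<ge>N. \<forall>a\<in>C. \<forall>b\<in>C. E t ((F ^^ n) a) ((F ^^ n') b)" ..
    then have "E t ((F ^^ N) a) ((F ^^ N) b)" using \<open>a \<in> C\<close> \<open>b \<in> C\<close> by blast
    then show "E t a b" by (simp add: iter)
  qed
  have "\<exists>a\<in>C. F a = a"
  proof -
    define c :: "(real \<Rightarrow> real ^ 'a) \<times> (real \<Rightarrow> real ^ 'b)"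
      where "c = ((\<lambda>t\<in>{0..}. axis undefined 1), (\<lambda>t\<in>{0..}. axis undefined 1))"
    have "c \<in> C"
      unfolding c_def C_def by (auto intro!: constant_control mixed_actions_axis)
    have "\<exists>N. 0 \<le> t \<longrightarrow> (\<forall>n\<ge>N. \<forall>n'\<ge>N. E t ((F ^^ n) c) ((F ^^ n') c))" for t
      using stable[of t] \<open>c \<in> C\<close> by blast
    then have "\<exists>N. \<forall>t. 0 \<le> t \<longrightarrow> (\<forall>n\<ge>N t. \<forall>n'\<ge>N t. E t ((F ^^ n) c) ((F ^^ n') c))"
      by (intro choice allI)
    then obtain N where N: "\<And>t n n'. \<lbrakk>0 \<le> t; N t \<le> n; N t \<le> n'\<rbrakk> \<Longrightarrow> E t ((F ^^ n) c) ((F ^^ n') c)"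
      by blast
    define l :: "(real \<Rightarrow> real ^ 'a) \<times> (real \<Rightarrow> real ^ 'b)"
      where "l = ((\<lambda>t\<in>{0..}. fst ((F ^^ N (t + 1)) c) t), (\<lambda>t\<in>{0..}. snd ((F ^^ N (t + 1)) c) t))"
    have l_val: "fst l s = fst ((F ^^ n) c) s \<and> snd l s = snd ((F ^^ n) c) s"
      if "0 \<le> s" "N (s + 1) \<le> n" for s n
      using N[of "s + 1" "N (s + 1)" n] that by (auto simp: l_def E_def)
    have l_E: "E t l ((F ^^ n) c)" if "0 \<le> t" "N t \<le> n" for t n
      unfolding E_def
    proof
      fix s assume s: "s \<in> {0..<t}"
      define m where "m = max n (N (s + 1))"
      have "E t ((F ^^ n) c) ((F ^^ m) c)" using N that by (simp add: m_def)
      then show "fst l s = fst ((F ^^ n) c) s \<and> snd l s = snd ((F ^^ n) c) s"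
        using l_val[of s m] s by (auto simp: E_def m_def)
    qed
    \<comment> \<open>At every time the iterates are eventually constant, so the limit is pointwise and measurable.\<close>
    have lim: "(\<lambda>n. fst ((F ^^ n) c) s) \<longlonglongrightarrow> fst l s" "(\<lambda>n. snd ((F ^^ n) c) s) \<longlonglongrightarrow> snd l s"
      if "0 \<le> s" for s
      using l_val[OF that] by (auto intro!: tendsto_eventually eventually_sequentiallyI[of "N (s + 1)"])
    have "fst l \<in> borel_measurable (lebesgue_on {0..})"
      by (rule borel_measurable_LIMSEQ_metric[of "\<lambda>n. fst ((F ^^ n) c)"])
         (use lim FnC[OF \<open>c \<in> C\<close>] in \<open>auto simp: C_def controls_def mem_Times_iff\<close>)
    moreover have "snd l \<in> borel_measurable (lebesgue_on {0..})"
      by (rule borel_measurable_LIMSEQ_metric[of "\<lambda>n. snd ((F ^^ n) c)"])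
         (use lim FnC[OF \<open>c \<in> C\<close>] in \<open>auto simp: C_def controls_def mem_Times_iff\<close>)
    moreover have "fst l \<in> {0..} \<rightarrow>\<^sub>E mixed_actions" "snd l \<in> {0..} \<rightarrow>\<^sub>E mixed_actions"
      using FnC[OF \<open>c \<in> C\<close>] by (auto simp: l_def C_def controls_def mem_Times_iff)
    ultimately have "l \<in> C" by (simp add: C_def controls_def mem_Times_iff)
    moreover have "F l = l"
    proof (rule C_eqI[OF FC])
      fix t :: real assume "0 \<le> t"
      have "E t (F l) (F ((F ^^ N t) c))"
        by (rule E_F[OF l_E[OF \<open>0 \<le> t\<close> order_refl] \<open>l \<in> C\<close> FnC[OF \<open>c \<in> C\<close>] \<open>0 \<le> t\<close>])
      moreover have "E t l ((F ^^ Suc (N t)) c)"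
        by (rule l_E[OF \<open>0 \<le> t\<close>]) simp
      ultimately show "E t (F l) l" by (simp add: E_def)
    qed (fact \<open>l \<in> C\<close>)+
    ultimately show ?thesis by blast
  qed
  then obtain l where l: "l \<in> C" "F l = l" by blast
  show ?thesis
  proof (rule ex1I[of _ l])
    show "case l of (a1, a2) \<Rightarrow> a1 \<in> controls \<and> a2 \<in> controls \<and> \<sigma>1 a2 = a1 \<and> \<sigma>2 a1 = a2"
      using l by (auto simp: C_def F_def)
    show "a = l" if "case a of (a1, a2) \<Rightarrow> a1 \<in> controls \<and> a2 \<in> controls \<and> \<sigma>1 a2 = a1 \<and> \<sigma>2 a1 = a2" for a
      using that by (intro unique[OF _ l(1) _ l(2)]) (auto simp: C_def F_def)
  qed
qed

lemma play_path_fixed: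
  assumes "\<sigma>1 \<in> strategies" "\<sigma>2 \<in> strategies"
  obtains a1 a2 where "play_path \<sigma>1 \<sigma>2 = (a1, a2)" "a1 \<in> controls" "a2 \<in> controls"
    "a1 = \<sigma>1 a2" "a2 = \<sigma>2 a1"
proof -
  have "case play_path \<sigma>1 \<sigma>2 of (a1, a2) \<Rightarrow>
      a1 \<in> controls \<and> a2 \<in> controls \<and> \<sigma>1 a2 = a1 \<and> \<sigma>2 a1 = a2"
    using theI'[OF ex1_play_path[OF assms]] by (simp add: play_path_def)
  moreover obtain a1 a2 where "play_path \<sigma>1 \<sigma>2 = (a1, a2)" by (rule prod.exhaust)
  ultimately show ?thesis by (intro that[of a1 a2]) simp_all
qed

section \<open>Payoff integrals\<close>

text \<open>
  Controls are defined on the whole half-line and are extensional. In the estimates for one period,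
  constants and restrictions have to be integrated as well, hence this local variant, which demands
  nothing outside \<open>A\<close>.
\<close>
definition controls_on :: "real set \<Rightarrow> (real \<Rightarrow> real ^ 'c::finite) set" where
  "controls_on A = (A \<rightarrow> mixed_actions) \<inter> borel_measurable (lebesgue_on A)"

lemma controls_imp_controls_on: "a \<in> controls \<Longrightarrow> A \<subseteq> {0..} \<Longrightarrow> a \<in> controls_on A"
  by (auto simp: controls_def controls_on_def intro: measurable_restrict_mono)

lemma const_controls_on: "p \<in> mixed_actions \<Longrightarrow> (\<lambda>_. p) \<in> controls_on A"
  by (simp add: controls_on_def)

lemma set_integrable_mixed_payoff:
  assumes A: "A \<in> lmeasurable" and a: "a1 \<in> controls_on A" "a2 \<in> controls_on A"
  shows "set_integrable lebesgue A (\<lambda>s. mixed_payoff u (a1 s) (a2 s))"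
proof -
  obtain M where M: "\<And>a b. norm (u a b) \<le> M" using payoffs_bounded[of u] by metis
  interpret finite_measure "lebesgue_on A" by (rule finite_measure_lebesgue_on[OF A])
  have "integrable (lebesgue_on A) (\<lambda>s. mixed_payoff u (a1 s) (a2 s))"
  proof (rule integrable_const_bound)
    show "AE s in lebesgue_on A. norm (mixed_payoff u (a1 s) (a2 s)) \<le> M"
      using a norm_mixed_payoff_le[of u M, OF M]
      by (intro AE_I2) (auto simp: controls_on_def Pi_iff)
    have [measurable]: "a1 \<in> borel_measurable (lebesgue_on A)" "a2 \<in> borel_measurable (lebesgue_on A)"
      using a by (auto simp: controls_on_def)
    show "(\<lambda>s. mixed_payoff u (a1 s) (a2 s)) \<in> borel_measurable (lebesgue_on A)"
      unfolding mixed_payoff_def cart_eq_inner_axis by measurable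
  qed
  then show ?thesis
    using A by (simp add: set_integrable_def integrable_restrict_space fmeasurableD)
qed

lemma lmeasurable_half_open: "{a..<b::real} \<in> lmeasurable"
  by (rule bounded_set_imp_lmeasurable) auto

lemma inner_payoff_integral_le:
  assumes A: "A \<in> lmeasurable" and a: "a1 \<in> controls_on A" "a2 \<in> controls_on A"
    and le: "\<And>s. s \<in> A \<Longrightarrow> l \<bullet> mixed_payoff u (a1 s) (a2 s) \<le> d"
  shows "l \<bullet> (LINT s:A|lebesgue. mixed_payoff u (a1 s) (a2 s)) \<le> d * measure lebesgue A"
proof -
  have int: "integrable lebesgue (\<lambda>s. indicator A s *\<^sub>R mixed_payoff u (a1 s) (a2 s))"
    using set_integrable_mixed_payoff[OF A a] by (simp add: set_integrable_def)
  have eq: "l \<bullet> (indicator A s *\<^sub>R mixed_payoff u (a1 s) (a2 s))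
      = indicator A s *\<^sub>R (l \<bullet> mixed_payoff u (a1 s) (a2 s))" for s
    by simp
  have "l \<bullet> (LINT s:A|lebesgue. mixed_payoff u (a1 s) (a2 s))
      = (LINT s:A|lebesgue. l \<bullet> mixed_payoff u (a1 s) (a2 s))"
    unfolding set_lebesgue_integral_def eq[symmetric] by (rule integral_inner_right[symmetric]) (rule int)
  also have "\<dots> \<le> (LINT s:A|lebesgue. d)"
  proof (rule set_integral_mono)
    show "set_integrable lebesgue A (\<lambda>s. l \<bullet> mixed_payoff u (a1 s) (a2 s))"
      unfolding set_integrable_def eq[symmetric] by (rule integrable_inner_right) (rule int)
    show "set_integrable lebesgue A (\<lambda>s. d)"
      unfolding set_integrable_def using A
      by (intro integrable_scaleR_left integrable_real_indicator) (auto simp: fmeasurable_def)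
  qed (fact le)
  also have "\<dots> = d * measure lebesgue A"
    using A by (subst set_integral_const) (auto simp: fmeasurable_def)
  finally show ?thesis .
qed

text \<open>
  The bound on projections, applied to the direction \<open>J\<close> of the integral itself.
\<close>
lemma norm_payoff_integral_le:
  assumes A: "A \<in> lmeasurable" and a: "a1 \<in> controls_on A" "a2 \<in> controls_on A"
    and M: "\<And>a b. norm (u a b) \<le> M"
  shows "norm (LINT s:A|lebesgue. mixed_payoff u (a1 s) (a2 s)) \<le> M * measure lebesgue A"
proof -
  define J where "J = (LINT s:A|lebesgue. mixed_payoff u (a1 s) (a2 s))"
  have "J \<bullet> mixed_payoff u (a1 s) (a2 s) \<le> norm J * M" if "s \<in> A" for s
  proof -
    have "norm (mixed_payoff u (a1 s) (a2 s)) \<le> M"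
      using a that by (intro norm_mixed_payoff_le M) (auto simp: controls_on_def)
    then show ?thesis
      using norm_cauchy_schwarz[of J] by (meson mult_left_mono norm_ge_zero order_trans)
  qed
  then have "J \<bullet> J \<le> norm J * M * measure lebesgue A"
    using inner_payoff_integral_le[OF A a] unfolding J_def by blast
  then have "norm J * norm J \<le> norm J * (M * measure lebesgue A)"
    by (simp add: power2_norm_eq_inner[symmetric] power2_eq_square mult.assoc)
  moreover have "0 \<le> M" using M norm_ge_zero order_trans by blast
  ultimately show ?thesis unfolding J_def[symmetric]
    by (cases "J = 0") auto
qed

section \<open>The pursuit strategy\<close>

text \<open>
  One period of the approach. The square of \<open>norm (g + J)\<close> is at most
  \<open>(norm g)\<^sup>2 - 2 * c * d * norm g + (M * d)\<^sup>2\<close>. If \<open>norm g\<close> exceeds \<open>d * M\<^sup>2 / c\<close>, then half of the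
  linear term absorbs the quadratic one, and completing the square shows a decrease by \<open>c * d / 2\<close>;
  otherwise the gap was already of order \<open>d\<close> and grows by at most \<open>M * d\<close>.
\<close>
lemma approach_step:
  fixes g J :: "'v::real_inner"
  assumes "0 < c" "c \<le> M" "0 \<le> d"
    and J: "norm J \<le> M * d" "g \<bullet> J \<le> - (c * norm g) * d"
  shows "norm (g + J) \<le> max (d * (M\<^sup>2 / c + M)) (norm g - c * d / 2)"
proof (cases "norm g \<le> d * (M\<^sup>2 / c)")
  case True
  then have "norm (g + J) \<le> d * (M\<^sup>2 / c + M)"
    using norm_triangle_ineq[of g J] J(1) by (simp add: algebra_simps)
  then show ?thesis by simp
next
  case False
  then have "d * M\<^sup>2 / c < norm g" by simp
  then have far: "d * M\<^sup>2 \<le> c * norm g"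
    using \<open>0 < c\<close> by (simp add: pos_divide_less_eq mult.commute)
  \<comment> \<open>Because of \<open>c \<le> M\<close>, a gap as large as this is at least \<open>c * d\<close>; so \<open>norm g - c * d / 2\<close> is
    nonnegative, and it suffices to compare squares.\<close>
  have "c\<^sup>2 \<le> M\<^sup>2" using assms by (intro power_mono) auto
  then have "d * c\<^sup>2 \<le> c * norm g" using far \<open>0 \<le> d\<close> mult_left_mono order_trans by blast
  then have "c * (c * d) \<le> c * norm g" by (simp add: power2_eq_square mult_ac)
  then have "c * d \<le> norm g" using \<open>0 < c\<close> by simp
  then have nonneg: "0 \<le> norm g - c * d / 2"
    using mult_nonneg_nonneg[of c d] \<open>0 < c\<close> \<open>0 \<le> d\<close> by linarith
  have "(norm (g + J))\<^sup>2 = (norm g)\<^sup>2 + 2 * (g \<bullet> J) + (norm J)\<^sup>2"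
    by (simp add: power2_norm_eq_inner inner_add_left inner_add_right inner_commute)
  also have "\<dots> \<le> (norm g)\<^sup>2 - 2 * (c * norm g * d) + (M * d)\<^sup>2"
    using J power_mono[of "norm J" "M * d" 2] by simp
  also have "(M * d)\<^sup>2 \<le> c * norm g * d"
    using mult_right_mono[OF far \<open>0 \<le> d\<close>] by (simp add: power2_eq_square mult_ac)
  finally have "(norm (g + J))\<^sup>2 \<le> (norm g)\<^sup>2 - c * norm g * d" by linarith
  also have "\<dots> \<le> (norm g - c * d / 2)\<^sup>2"
    using zero_le_power2[of "c * d"] by (simp add: power2_eq_square algebra_simps)
  finally have "norm (g + J) \<le> norm g - c * d / 2" by (rule power2_le_imp_le[OF _ nonneg])
  then show ?thesis by (rule max.coboundedI2)
qed

text \<open>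
  The cumulative payoff minus the target \<open>x\<close> at time \<open>k * d\<close>, computed by Player 1 from the observed
  control \<open>y\<close> of the opponent, when \<open>P g\<close> is played throughout a period that begins with the gap \<open>g\<close>.
\<close>
primrec pursuit_gap ::
  "('a::finite \<Rightarrow> 'b::finite \<Rightarrow> real ^ 'm) \<Rightarrow> (real ^ 'm \<Rightarrow> real ^ 'a) \<Rightarrow> real \<Rightarrow> real ^ 'm
    \<Rightarrow> (real \<Rightarrow> real ^ 'b) \<Rightarrow> nat \<Rightarrow> real ^ 'm" where
  "pursuit_gap u P d x y 0 = - x"
| "pursuit_gap u P d x y (Suc k) = pursuit_gap u P d x y k
    + (LINT s:{real k * d..<real (Suc k) * d}|lebesgue. mixed_payoff u (P (pursuit_gap u P d x y k)) (y s))"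

definition pursuit ::
  "('a::finite \<Rightarrow> 'b::finite \<Rightarrow> real ^ 'm) \<Rightarrow> (real ^ 'm \<Rightarrow> real ^ 'a) \<Rightarrow> real \<Rightarrow> real ^ 'm
    \<Rightarrow> (real \<Rightarrow> real ^ 'b) \<Rightarrow> real \<Rightarrow> real ^ 'a" where
  "pursuit u P d x y = (\<lambda>t\<in>{0..}. P (pursuit_gap u P d x y (nat \<lfloor>t / d\<rfloor>)))"

lemma pursuit_slot:
  assumes "0 < d" "real k * d \<le> t" "t < real (Suc k) * d"
  shows "pursuit u P d x y t = P (pursuit_gap u P d x y k)"
proof -
  have "\<lfloor>t / d\<rfloor> = int k"
    using assms by (simp add: floor_eq_iff pos_le_divide_eq pos_divide_less_eq algebra_simps)
  moreover have "0 \<le> t" using assms by (meson mult_nonneg_nonneg of_nat_0_le_iff less_imp_le order_trans)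
  ultimately show ?thesis by (simp add: pursuit_def)
qed

lemma pursuit_gap_cong:
  assumes "0 < d" "\<forall>t\<in>{0..<real k * d}. y t = y' t"
  shows "pursuit_gap u P d x y k = pursuit_gap u P d x y' k"
  using assms(2)
proof (induction k)
  case (Suc k)
  have "real k * d \<le> real (Suc k) * d" "0 \<le> real k * d" using \<open>0 < d\<close> by auto
  then have "pursuit_gap u P d x y k = pursuit_gap u P d x y' k"
    and eq: "\<And>s. s \<in> {real k * d..<real (Suc k) * d} \<Longrightarrow> y s = y' s"
    using Suc by auto
  moreover have "(LINT s:{real k * d..<real (Suc k) * d}|lebesgue. mixed_payoff u p (y s))
      = (LINT s:{real k * d..<real (Suc k) * d}|lebesgue. mixed_payoff u p (y' s))" for p
    by (rule set_lebesgue_integral_cong) (simp_all add: eq)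
  ultimately show ?case by (simp del: of_nat_Suc)
qed simp

lemma pursuit_strategy:
  fixes u :: "'a::finite \<Rightarrow> 'b::finite \<Rightarrow> real ^ 'm"
  assumes "0 < d" "\<And>g. P g \<in> mixed_actions"
  shows "pursuit u P d x \<in> strategies"
proof -
  have "pursuit u P d x y \<in> controls" for y
  proof -
    have "(\<lambda>t. P (pursuit_gap u P d x y (nat \<lfloor>t / d\<rfloor>))) \<in> borel_measurable borel"
      by (rule measurable_compose[of _ _ "count_space UNIV"]) simp_all
    then have "(\<lambda>t. P (pursuit_gap u P d x y (nat \<lfloor>t / d\<rfloor>))) \<in> borel_measurable (lebesgue_on {0..})"
      by (intro measurable_restrict_space1 measurable_completion) simp
    then have "pursuit u P d x y \<in> borel_measurable (lebesgue_on {0..})"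
      by (subst measurable_cong[where g = "\<lambda>t. P (pursuit_gap u P d x y (nat \<lfloor>t / d\<rfloor>))"])
        (auto simp: pursuit_def)
    then show ?thesis using assms(2) by (auto simp: controls_def pursuit_def)
  qed
  moreover have "delay_grid (pursuit u P d x) (\<lambda>k. real k * d)"
    unfolding delay_grid_def
  proof (intro conjI ballI allI impI)
    fix y y' :: "real \<Rightarrow> real ^ 'b" and k t
    assume "\<forall>t\<in>{0..<real k * d}. y t = y' t" and t: "t \<in> {real k * d..<real (Suc k) * d}"
    then have "pursuit_gap u P d x y k = pursuit_gap u P d x y' k"
      by (intro pursuit_gap_cong[OF \<open>0 < d\<close>])
    then show "pursuit u P d x y t = pursuit u P d x y' t"
      using t \<open>0 < d\<close> by (simp add: pursuit_slot[of d k] del: of_nat_Suc)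
  qed (rule time_grid_uniform[OF \<open>0 < d\<close>])
  ultimately show ?thesis by (auto simp: strategies_eq)
qed

text \<open>
  The gap that the strategy keeps in its recursion is the one realised on the play path.
\<close>
lemma pursuit_gap_payoff:
  assumes "0 < d" "pursuit u P d x a2 \<in> controls" "a2 \<in> controls"
  shows "(LINT s:{0..<real k * d}|lebesgue. mixed_payoff u (pursuit u P d x a2 s) (a2 s))
    = x + pursuit_gap u P d x a2 k"
proof (induction k)
  case 0
  then show ?case by (simp add: set_lebesgue_integral_def)
next
  case (Suc k)
  let ?f = "\<lambda>s. mixed_payoff u (pursuit u P d x a2 s) (a2 s)"
  let ?I = "{real k * d..<real (Suc k) * d}"
  have le: "0 \<le> real k * d" "real k * d \<le> real (Suc k) * d" using \<open>0 < d\<close> by auto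
  have int: "set_integrable lebesgue A ?f" if "A \<subseteq> {0..}" "A \<in> lmeasurable" for A
    using that assms(2,3) by (intro set_integrable_mixed_payoff controls_imp_controls_on)
  have "{0..<real (Suc k) * d} = {0..<real k * d} \<union> ?I" using le by auto
  then have "(LINT s:{0..<real (Suc k) * d}|lebesgue. ?f s)
      = (LINT s:{0..<real k * d}|lebesgue. ?f s) + (LINT s:?I|lebesgue. ?f s)"
    using le by (simp only:, intro set_integral_Un int lmeasurable_half_open) auto
  also have "(LINT s:?I|lebesgue. ?f s)
      = (LINT s:?I|lebesgue. mixed_payoff u (P (pursuit_gap u P d x a2 k)) (a2 s))"
    by (rule set_lebesgue_integral_cong) (use \<open>0 < d\<close> in \<open>auto simp: pursuit_slot[of d k] simp del: of_nat_Suc\<close>)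
  finally show ?case using Suc by simp
qed

text \<open>
  The gap decreases at the speed \<open>c / 2\<close> from its initial length \<open>norm x\<close>, down to a level
  proportional to \<open>d\<close>, above which it does not return.
\<close>
lemma pursuit_gap_le:
  fixes u :: "'a::finite \<Rightarrow> 'b::finite \<Rightarrow> real ^ 'm::finite"
  assumes "0 < c" "c \<le> M" "0 < d" "a2 \<in> controls"
    and M: "\<And>a b. norm (u a b) \<le> M"
    and P: "\<And>g. P g \<in> mixed_actions"
      "\<And>g q. q \<in> mixed_actions \<Longrightarrow> g \<bullet> mixed_payoff u (P g) q \<le> - (c * norm g)"
  shows "norm (pursuit_gap u P d x a2 k) \<le> max (d * (M\<^sup>2 / c + M)) (norm x - real k * (c * d / 2))"
proof (induction k)
  case 0
  then show ?case by simp
next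
  case (Suc k)
  define g where "g = pursuit_gap u P d x a2 k"
  define I where "I = {real k * d..<real (Suc k) * d}"
  define J where "J = (LINT s:I|lebesgue. mixed_payoff u (P g) (a2 s))"
  have "I \<subseteq> {0..}"
  proof -
    have "0 \<le> real k * d" using \<open>0 < d\<close> by simp
    then show ?thesis unfolding I_def by fastforce
  qed
  then have a2: "a2 \<in> controls_on I" using assms(4) by (rule controls_imp_controls_on[rotated])
  have "I \<in> lmeasurable" unfolding I_def by (rule lmeasurable_half_open)
  have "measure lebesgue I = d" using \<open>0 < d\<close> by (simp add: I_def algebra_simps)
  then have "norm J \<le> M * d"
    using norm_payoff_integral_le[where u = u, OF \<open>I \<in> lmeasurable\<close> const_controls_on[OF P(1)] a2 M]
    unfolding J_def by metis
  moreover have "g \<bullet> J \<le> - (c * norm g) * measure lebesgue I"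
    unfolding J_def
    by (rule inner_payoff_integral_le[OF \<open>I \<in> lmeasurable\<close> const_controls_on[OF P(1)] a2])
      (use a2 in \<open>auto simp: controls_on_def intro!: P(2)\<close>)
  ultimately have "norm (g + J) \<le> max (d * (M\<^sup>2 / c + M)) (norm g - c * d / 2)"
    using assms(1-3) \<open>measure lebesgue I = d\<close> by (intro approach_step) auto
  moreover have "pursuit_gap u P d x a2 (Suc k) = g + J"
    by (simp add: g_def J_def I_def)
  moreover have "norm g \<le> max (d * (M\<^sup>2 / c + M)) (norm x - real k * (c * d / 2))"
    using Suc by (simp add: g_def)
  moreover have "a \<le> max B (f - e)" if "a \<le> max B (b - e)" "b \<le> max B f" "0 < e"
    for a b e f B :: real
    using that by (auto simp: max_def split: if_splits)
  moreover have "0 < c * d / 2" using \<open>0 < c\<close> \<open>0 < d\<close> by simp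
  moreover have eq: "norm x - real (Suc k) * (c * d / 2) = norm x - real k * (c * d / 2) - c * d / 2"
    by (simp add: algebra_simps)
  ultimately show ?case unfolding eq by metis
qed

text \<open>
  At time \<open>2 * norm x / c'\<close> the gap is at most of order \<open>d\<close>. One more time unit covers the
  period under way, because \<open>d \<le> 1\<close>; so the waiting time does not depend on \<open>\<epsilon>\<close>. Within
  a period the gap moves by at most \<open>M * d\<close>, and \<open>d\<close> is chosen to make the total \<open>d * K\<close> at most
  \<open>\<epsilon>\<close>.
\<close>
lemma attainable_of_advantage:
  fixes u :: "'a::finite \<Rightarrow> 'b::finite \<Rightarrow> real ^ 'm::finite"
  assumes "0 < c"
    and adv: "\<And>l. \<exists>p\<in>mixed_actions. \<forall>q\<in>mixed_actions. c * norm l \<le> l \<bullet> mixed_payoff u p q"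
  shows "attainable u x"
proof -
  obtain M where "1 \<le> M" and M: "\<And>a b. norm (u a b) \<le> M" using payoffs_bounded[of u] by metis
  \<comment> \<open>A smaller constant is still an advantage, and is at most \<open>M\<close> as the approach estimate requires.\<close>
  define c' where "c' = min c 1"
  have c': "0 < c'" "c' \<le> M" "c' \<le> c" using \<open>0 < c\<close> \<open>1 \<le> M\<close> by (auto simp: c'_def)
  have "\<exists>p. p \<in> mixed_actions \<and> (\<forall>q\<in>mixed_actions. g \<bullet> mixed_payoff u p q \<le> - (c' * norm g))" for g
  proof -
    obtain p where p: "p \<in> mixed_actions" "\<And>q. q \<in> mixed_actions \<Longrightarrow> c * norm (- g) \<le> - g \<bullet> mixed_payoff u p q"
      using adv[of "- g"] by blast
    have "c' * norm g \<le> c * norm g" using c'(3) by (simp add: mult_right_mono)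
    then show ?thesis using p by (force intro!: exI[of _ p])
  qed
  then obtain P where P: "\<And>g. P g \<in> mixed_actions"
    "\<And>g q. q \<in> mixed_actions \<Longrightarrow> g \<bullet> mixed_payoff u (P g) q \<le> - (c' * norm g)"
    by metis
  define T where "T = 2 * norm x / c' + 1"
  have "0 < T" using c'(1) by (simp add: T_def add_nonneg_pos)
  moreover have "\<exists>\<sigma>1\<in>strategies. \<forall>t\<ge>T. \<forall>\<sigma>2\<in>strategies.
      infdist (cumulative_payoff u \<sigma>1 \<sigma>2 t) {x} \<le> \<epsilon>" if "0 < \<epsilon>" for \<epsilon>
  proof -
    define K where "K = M\<^sup>2 / c' + 2 * M"
    have "0 < K" using \<open>1 \<le> M\<close> c'(1) by (simp add: K_def add_nonneg_pos)
    define d where "d = min 1 (\<epsilon> / K)"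
    have d: "0 < d" "d \<le> 1" using \<open>0 < \<epsilon>\<close> \<open>0 < K\<close> by (auto simp: d_def)
    have "d \<le> \<epsilon> / K" by (simp add: d_def)
    then have "d * K \<le> \<epsilon>" using \<open>0 < K\<close> by (simp add: pos_le_divide_eq)
    have strat: "pursuit u P d x \<in> strategies" by (rule pursuit_strategy[OF d(1) P(1)])
    have "infdist (cumulative_payoff u (pursuit u P d x) \<sigma>2 t) {x} \<le> \<epsilon>"
      if "T \<le> t" "\<sigma>2 \<in> strategies" for t \<sigma>2
    proof -
      obtain a1 a2 where path: "play_path (pursuit u P d x) \<sigma>2 = (a1, a2)"
        and a: "a1 \<in> controls" "a2 \<in> controls" and a1: "a1 = pursuit u P d x a2"
        using play_path_fixed[OF strat \<open>\<sigma>2 \<in> strategies\<close>] by metis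
      have "0 \<le> t" using \<open>0 < T\<close> \<open>T \<le> t\<close> by simp
      obtain k where k: "real k * d \<le> t" "t < real (Suc k) * d"
        using time_grid_slot[OF time_grid_uniform[OF d(1)] \<open>0 \<le> t\<close>] .
      define I where "I = {real k * d..t}"
      have "0 \<le> real k * d" using d(1) by simp
      then have "I \<subseteq> {0..}" by (auto simp: I_def)
      have "I \<in> lmeasurable" by (simp add: I_def)
      have aI: "a1 \<in> controls_on I" "a2 \<in> controls_on I"
        using a \<open>I \<subseteq> {0..}\<close> by (auto intro: controls_imp_controls_on)
      have aH: "a1 \<in> controls_on {0..<real k * d}" "a2 \<in> controls_on {0..<real k * d}"
        using a by (auto intro!: controls_imp_controls_on)
      define J where "J = (LINT s:I|lebesgue. mixed_payoff u (a1 s) (a2 s))"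
      have "measure lebesgue I \<le> d" using k by (simp add: I_def algebra_simps)
      then have "norm J \<le> M * d"
        using norm_payoff_integral_le[where u = u, OF \<open>I \<in> lmeasurable\<close> aI M] \<open>1 \<le> M\<close>
          mult_left_mono[of "measure lebesgue I" d M] unfolding J_def by linarith
      have "{0..t} = {0..<real k * d} \<union> I" using k(1) \<open>0 \<le> real k * d\<close> by (auto simp: I_def)
      moreover have "(LINT s:{0..<real k * d} \<union> I|lebesgue. mixed_payoff u (a1 s) (a2 s))
          = (LINT s:{0..<real k * d}|lebesgue. mixed_payoff u (a1 s) (a2 s)) + J"
        unfolding J_def
        by (intro set_integral_Un set_integrable_mixed_payoff aI aH \<open>I \<in> lmeasurable\<close> lmeasurable_half_open)
          (auto simp: I_def)
      ultimately have "cumulative_payoff u (pursuit u P d x) \<sigma>2 t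
          = x + pursuit_gap u P d x a2 k + J"
        using pursuit_gap_payoff[of d u P x a2 k] d(1) a
        by (simp add: cumulative_payoff_def path a1)
      moreover have "norm (pursuit_gap u P d x a2 k) \<le> d * (M\<^sup>2 / c' + M)"
      proof -
        have "2 * norm x / c' < real k * d"
          using k(2) d(2) \<open>T \<le> t\<close> by (simp add: T_def algebra_simps)
        then have "norm x - real k * (c' * d / 2) \<le> 0"
          using c'(1) by (simp add: pos_divide_less_eq algebra_simps)
        moreover have "0 \<le> d * (M\<^sup>2 / c' + M)"
          using d(1) c'(1) \<open>1 \<le> M\<close> by simp
        ultimately show ?thesis
          using pursuit_gap_le[where P = P and x = x and k = k, OF c'(1,2) d(1) a(2) M P] by linarith
      qed
      ultimately have "dist (cumulative_payoff u (pursuit u P d x) \<sigma>2 t) x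
          \<le> d * (M\<^sup>2 / c' + M) + M * d"
        using norm_triangle_ineq[of "pursuit_gap u P d x a2 k" J] \<open>norm J \<le> M * d\<close>
        by (simp add: dist_norm add.assoc)
      also have "\<dots> = d * K" by (simp add: K_def algebra_simps)
      finally show ?thesis using \<open>d * K \<le> \<epsilon>\<close> by simp
    qed
    then show ?thesis using strat by blast
  qed
  ultimately show ?thesis
    unfolding attainable_def attainable_set_def by auto
qed

section \<open>The equivalence\<close>

lemma constant_strategy:
  assumes "q \<in> mixed_actions"
  shows "(\<lambda>_. \<lambda>t\<in>{0..}. q) \<in> strategies"
proof -
  have "delay_grid (\<lambda>_. \<lambda>t\<in>{0..}. q) (\<lambda>k. real k * 1)"
    unfolding delay_grid_def using time_grid_uniform[of 1] by auto
  then show ?thesis using constant_control[OF assms] by (auto simp: strategies_eq)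
qed

text \<open>
  Against the constant action \<open>q\<close> the cumulative payoff never leaves the half-space
  \<open>{y. l \<bullet> y \<le> 0}\<close>, whose distance from \<open>l\<close> is \<open>norm l\<close>; the tolerance \<open>norm l / 2\<close> is therefore
  out of reach.
\<close>
lemma not_attainable_against_defence:
  fixes u :: "'a::finite \<Rightarrow> 'b::finite \<Rightarrow> real ^ 'm::finite"
  assumes q: "q \<in> mixed_actions" "\<And>p. p \<in> mixed_actions \<Longrightarrow> l \<bullet> mixed_payoff u p q \<le> 0"
    and "l \<noteq> 0"
  shows "\<not> attainable u l"
proof
  assume "attainable u l"
  then obtain T where "0 < T"
    and T: "\<And>\<epsilon>. 0 < \<epsilon> \<Longrightarrow> \<exists>\<sigma>1\<in>strategies. \<forall>t\<ge>T. \<forall>\<sigma>2\<in>strategies.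
      infdist (cumulative_payoff u \<sigma>1 \<sigma>2 t) {l} \<le> \<epsilon>"
    unfolding attainable_def attainable_set_def by blast
  define \<sigma>2 :: "(real \<Rightarrow> real ^ 'a) \<Rightarrow> real \<Rightarrow> real ^ 'b" where "\<sigma>2 = (\<lambda>_. \<lambda>t\<in>{0..}. q)"
  have "\<sigma>2 \<in> strategies" unfolding \<sigma>2_def by (rule constant_strategy[OF q(1)])
  then obtain \<sigma>1 where "\<sigma>1 \<in> strategies"
    and near: "infdist (cumulative_payoff u \<sigma>1 \<sigma>2 T) {l} \<le> norm l / 2"
    using T[of "norm l / 2"] \<open>l \<noteq> 0\<close> by fastforce
  obtain a1 a2 where path: "play_path \<sigma>1 \<sigma>2 = (a1, a2)"
    and a: "a1 \<in> controls" "a2 \<in> controls" and a2: "a2 = \<sigma>2 a1"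
    using play_path_fixed[OF \<open>\<sigma>1 \<in> strategies\<close> \<open>\<sigma>2 \<in> strategies\<close>] by metis
  define \<gamma> where "\<gamma> = cumulative_payoff u \<sigma>1 \<sigma>2 T"
  have "l \<bullet> \<gamma> \<le> 0 * measure lebesgue {0..T}"
    unfolding \<gamma>_def cumulative_payoff_def path prod.case
  proof (rule inner_payoff_integral_le)
    show "l \<bullet> mixed_payoff u (a1 s) (a2 s) \<le> 0" if "s \<in> {0..T}" for s
      using that a(1) by (auto simp: a2 \<sigma>2_def controls_def intro!: q(2))
  qed (use a in \<open>auto intro!: controls_imp_controls_on\<close>)
  moreover have "(norm l)\<^sup>2 \<le> l \<bullet> \<gamma> + norm l * norm (l - \<gamma>)"
    using norm_cauchy_schwarz[of l "l - \<gamma>"] by (simp add: inner_diff_right power2_norm_eq_inner)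
  moreover have "norm l * norm (l - \<gamma>) \<le> norm l * (norm l / 2)"
    using near by (intro mult_left_mono) (auto simp: \<gamma>_def dist_norm norm_minus_commute)
  ultimately have "(norm l)\<^sup>2 \<le> (norm l)\<^sup>2 / 2" by (simp add: power2_eq_square)
  then show False using \<open>l \<noteq> 0\<close> by simp
qed

theorem theorem2:
  fixes u :: "'a::finite \<Rightarrow> 'b::finite \<Rightarrow> real ^ 'm::finite"
  assumes "\<And>a b i. u a b $ i \<in> {-1..1}"
  shows "(\<forall>x :: real ^ 'm. attainable u x) \<longleftrightarrow> (\<forall>l :: real ^ 'm. l \<noteq> 0 \<longrightarrow> projected_value u l > 0)"
proof (intro iffI allI impI)
  fix l :: "real ^ 'm"
  assume "\<forall>x. attainable u x" "l \<noteq> 0"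
  then show "0 < projected_value u l"
    using opponent_defends not_attainable_against_defence by blast
next
  fix x :: "real ^ 'm"
  assume "\<forall>l. l \<noteq> 0 \<longrightarrow> 0 < projected_value u l"
  then obtain c where "0 < c"
    "\<And>l. \<exists>p\<in>mixed_actions. \<forall>q\<in>mixed_actions. c * norm l \<le> l \<bullet> mixed_payoff u p q"
    using uniform_advantage[of u] by blast
  then show "attainable u x" by (rule attainable_of_advantage)
qed

end
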